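(* Let $f: 2^{E}\times O^E\rightarrow \mathbb{R}_{\geq0}$ be adaptive submodular with respect to $p(\phi)$, and let $(E,\mathcal{I})$ be a $k$-system for an integer $k\ge1$. Let $\pi^{sag}$ be the sampling-based adaptive greedy policy (defined in the context) with parameters $\delta_1=1/2$ and $\delta_0=1/2$. Then \[ f_{avg}(\pi^{sag})\geq \frac{1}{2k+4}f_{avg}(\pi^{opt}). \]
   Context: Let $E$ be a finite set of $n$ items and $O$ a finite set of states. A realization is a map $\phi:E\to O$; $\Phi$ is a random realization with known prior $p(\phi)=\Pr[\Phi=\phi]$ over the set $U$ of realizations, and $U^+=\{\phi\in U:p(\phi)>0\}$. A partial realization is a map $\psi:S\to O$, $S\subseteq E$, with $\mathrm{dom}(\psi)=S$; $\psi\prec\phi$ means $\psi$ agrees with $\phi$ on $\mathrm{dom}(\psi)$; $\psi\subseteq\psi'$ means $\mathrm{dom}(\psi)\subseteq\mathrm{dom}(\psi')$ and they agree on $\mathrm{dom}(\psi)$. The utility is $f:2^E\times O^E\to\mathbb{R}_{\ge0}$, and $\Delta(e\mid\psi)=\mathbb{E}_\Phi[f(\mathrm{dom}(\psi)\cup\{e\},\Phi)-f(\mathrm{dom}(\psi),\Phi)\mid\psi\prec\Phi]$. $f$ is adaptive submodular w.r.t. $p$ if $\Delta(e\mid\psi)\ge\Delta(e\mid\psi')$ whenever $\psi\subseteq\psi'$ and $e\notin\mathrm{dom}(\psi')$. A (possibly randomized) policy sequentially selects items, each choice depending on the states observed for previously selected items (selecting an item reveals its state). $E(\pi,\phi)$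 is the set of items selected by $\pi$ under $\phi$; $f_{avg}(\pi)=\mathbb{E}_{\Phi,\pi}[f(E(\pi,\Phi),\Phi)]$, the expectation over $\Phi$ and the internal randomness of $\pi$. An independence system $(E,\mathcal{I})$ is a nonempty family $\mathcal{I}\subseteq 2^E$ with $\emptyset\in\mathcal{I}$ that is downward closed. For $R\subseteq E$, a base of $R$ is a maximal (under inclusion) set in $\{A\in\mathcal{I}: A\subseteq R\}$. $(E,\mathcal{I})$ is a $k$-system if for every $R\subseteq E$ the ratio of the sizes of the largest and smallest bases of $R$ is at most $k$. Feasible policies: $\Omega=\{\pi: E(\pi,\phi)\in\mathcal{I}\text{ for all }\phi\in U^+\}$, and $\pi^{opt}\in\arg\max_{\pi\in\Omega}f_{avg}(\pi)$. Greedy policy on a set $S$: starting with $\psi_0=\emptyset$ and $V=\emptyset$, in each round $t$ let $F$ be the set of $e\in S\setminus V$ with $V\cup\{e\}\in\mathcal{I}$ and $\Delta(e\mid\psi_{t-1})>0$; if $F=\emptyset$ stop; otherwise select $e_t\in\arg\max_{e\in F}\Delta(e\mid\psi_{t-1})$, observe $\Phi(e_t)$, set $\psi_t=\psi_{t-1}\cup\{(e_t,\Phi(e_t))\}$ and $V\leftarrow V\cup\{e_t\}$. The policy $\pi^{sag}$ with parameters $\delta_0,\delta_1\in(0,1)$: independently of $\Phi$, draw a random partition $E=S_1\cup S_2$ in which each item is placed in $S_1$ independently with probability $\delta_0$ and otherwise in $S_2$; with probability $\delta_1$ run the greedy policy on $S_1$, and with probability $1-\delta_1$ run the greedy policy on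 $S_2$.
   Formalization: Ties in the greedy argmax are broken by an arbitrary ranking of the items that may depend on the partial realization but not on the sampled set; if ties may be broken differently for each sampled set, the bound fails for large k (e.g. k = 100). *)

theory Defs
  imports "HOL-Probability.Probability"
begin

text \<open>
  Items are the elements of a finite type \<open>'e\<close>, states those of a finite type \<open>'o\<close>. The prior is a
  \<open>pmf\<close> over realizations, so that its support \<open>set_pmf p\<close> is the set of realizations of positive
  probability. A partial realization is a map, compared by \<open>\<subseteq>\<^sub>m\<close>.
\<close>

type_synonym ('e, 'o) realization = "'e \<Rightarrow> 'o"
type_synonym ('e, 'o) partial = "'e \<rightharpoonup> 'o"
type_synonym ('e, 'o) utility = "'e set \<Rightarrow> ('e, 'o) realization \<Rightarrow> real"

definition consistent :: "('e, 'o) partial \<Rightarrow> ('e, 'o) realization \<Rightarrow> bool" (infix "\<prec>" 50) where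
  "\<psi> \<prec> \<phi> \<longleftrightarrow> \<psi> \<subseteq>\<^sub>m (Some \<circ> \<phi>)"

text \<open>
  \<open>cond_pmf p A\<close> is meaningful only if \<open>A\<close> has positive probability; a partial realization for
  which this holds is called observable.
\<close>

definition observable :: "('e, 'o) realization pmf \<Rightarrow> ('e, 'o) partial \<Rightarrow> bool" where
  "observable p \<psi> \<longleftrightarrow> (\<exists>\<phi>\<in>set_pmf p. \<psi> \<prec> \<phi>)"

definition marginal ::
    "('e, 'o) realization pmf \<Rightarrow> ('e, 'o) utility \<Rightarrow> 'e \<Rightarrow> ('e, 'o) partial \<Rightarrow> real" where
  "marginal p f e \<psi> =
     measure_pmf.expectation (cond_pmf p {\<phi>. \<psi> \<prec> \<phi>})
       (\<lambda>\<phi>. f (dom \<psi> \<union> {e}) \<phi> - f (dom \<psi>) \<phi>)"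

text \<open>
  Conditional expectations given an event of probability zero are undefined, hence the restriction
  to observable \<open>\<psi>'\<close> (which makes \<open>\<psi>\<close> observable as well).
\<close>

definition adaptive_submodular ::
    "('e, 'o) realization pmf \<Rightarrow> ('e, 'o) utility \<Rightarrow> bool" where
  "adaptive_submodular p f \<longleftrightarrow>
     (\<forall>\<psi> \<psi>' e. \<psi> \<subseteq>\<^sub>m \<psi>' \<longrightarrow> observable p \<psi>' \<longrightarrow> e \<notin> dom \<psi>' \<longrightarrow>
        marginal p f e \<psi> \<ge> marginal p f e \<psi>')"

definition independence_system :: "'e set set \<Rightarrow> bool" where
  "independence_system \<I> \<longleftrightarrow> {} \<in> \<I> \<and> (\<forall>A\<in>\<I>. \<forall>B\<subseteq>A. B \<in> \<I>)"

definition bases :: "'e set set \<Rightarrow> 'e set \<Rightarrow> 'e set set" where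
  "bases \<I> R = {A \<in> \<I>. A \<subseteq> R \<and> (\<forall>B\<in>\<I>. A \<subseteq> B \<and> B \<subseteq> R \<longrightarrow> B = A)}"

text \<open>
  The condition on the ratio is cross-multiplied, because a smallest base may be empty (and then
  every base of the same set is).
\<close>

definition k_system :: "nat \<Rightarrow> 'e set set \<Rightarrow> bool" where
  "k_system k \<I> \<longleftrightarrow> independence_system \<I> \<and>
     (\<forall>R. Max (card ` bases \<I> R) \<le> k * Min (card ` bases \<I> R))"

text \<open>
  A deterministic policy maps the current observations to the next item, or to \<open>None\<close> in order to
  stop. Choosing an item that has already been selected does not change the observations, hence
  amounts to stopping; so \<open>CARD('e)\<close> rounds always suffice. A randomized policy is a probability
  distribution over deterministic policies, drawn independently of the realization; a deterministic
  policy is the special case of a point distribution.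
\<close>

type_synonym ('e, 'o) det_policy = "('e, 'o) partial \<Rightarrow> 'e option"
type_synonym ('e, 'o) policy = "('e, 'o) det_policy pmf"

definition policy_step ::
    "('e, 'o) det_policy \<Rightarrow> ('e, 'o) realization \<Rightarrow> ('e, 'o) partial \<Rightarrow> ('e, 'o) partial" where
  "policy_step \<pi> \<phi> \<psi> = (case \<pi> \<psi> of None \<Rightarrow> \<psi> | Some e \<Rightarrow> \<psi>(e \<mapsto> \<phi> e))"

definition selected ::
    "('e::finite, 'o) det_policy \<Rightarrow> ('e, 'o) realization \<Rightarrow> 'e set" where
  "selected \<pi> \<phi> = dom ((policy_step \<pi> \<phi> ^^ CARD('e)) Map.empty)"

definition f_avg ::
    "('e::finite, 'o) realization pmf \<Rightarrow> ('e, 'o) utility \<Rightarrow> ('e, 'o) policy \<Rightarrow> real" where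
  "f_avg p f \<rho> = measure_pmf.expectation (pair_pmf p \<rho>) (\<lambda>(\<phi>, \<pi>). f (selected \<pi> \<phi>) \<phi>)"

definition feasible_policies ::
    "('e::finite, 'o) realization pmf \<Rightarrow> 'e set set \<Rightarrow> ('e, 'o) policy set" where
  "feasible_policies p \<I> = {\<rho>. \<forall>\<pi>\<in>set_pmf \<rho>. \<forall>\<phi>\<in>set_pmf p. selected \<pi> \<phi> \<in> \<I>}"

definition greedy_candidates ::
    "('e, 'o) realization pmf \<Rightarrow> ('e, 'o) utility \<Rightarrow> 'e set set \<Rightarrow> 'e set \<Rightarrow>
     ('e, 'o) partial \<Rightarrow> 'e set" where
  "greedy_candidates p f \<I> S \<psi> =
     {e \<in> S - dom \<psi>. dom \<psi> \<union> {e} \<in> \<I> \<and> marginal p f e \<psi> > 0}"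

text \<open>
  Among the candidates of maximal marginal value the greedy policy takes the one ranked first by
  \<open>rk \<psi>\<close>. The ranking is arbitrary and may depend on the observations \<open>\<psi>\<close>, but not on \<open>S\<close>: ties are
  broken in the same way for every set \<open>S\<close> the policy is run on.
\<close>

definition greedy_policy ::
    "('e, 'o) realization pmf \<Rightarrow> ('e, 'o) utility \<Rightarrow> 'e set set \<Rightarrow>
     (('e, 'o) partial \<Rightarrow> 'e \<Rightarrow> nat) \<Rightarrow> 'e set \<Rightarrow> ('e, 'o) det_policy" where
  "greedy_policy p f \<I> rk S \<psi> =
     (let F = greedy_candidates p f \<I> S \<psi>;
          M = {e \<in> F. \<forall>e'\<in>F. marginal p f e' \<psi> \<le> marginal p f e \<psi>}
      in if F = {} then None else Some (arg_min_on (rk \<psi>) M))"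

definition sag_policy ::
    "real \<Rightarrow> real \<Rightarrow> ('e::finite, 'o) realization pmf \<Rightarrow> ('e, 'o) utility \<Rightarrow> 'e set set \<Rightarrow>
     (('e, 'o) partial \<Rightarrow> 'e \<Rightarrow> nat) \<Rightarrow> ('e, 'o) policy" where
  "sag_policy \<delta>\<^sub>0 \<delta>\<^sub>1 p f \<I> rk =
     bind_pmf (Pi_pmf UNIV False (\<lambda>_. bernoulli_pmf \<delta>\<^sub>0)) (\<lambda>x.
       bind_pmf (bernoulli_pmf \<delta>\<^sub>1) (\<lambda>first.
         let S\<^sub>1 = {e. x e}; S\<^sub>2 = {e. \<not> x e}
         in return_pmf (greedy_policy p f \<I> rk (if first then S\<^sub>1 else S\<^sub>2))))"

text \<open>A best feasible policy exists; one can even be found among the deterministic policies.\<close>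

lemma f_avg_eq:
  fixes p :: "('e::finite, 'o::finite) realization pmf"
  shows "f_avg p f \<rho> = measure_pmf.expectation \<rho> (\<lambda>\<pi>. f_avg p f (return_pmf \<pi>))"
proof -
  have "f_avg p f \<rho> = (\<Sum>(\<phi>, \<pi>)\<in>UNIV. f (selected \<pi> \<phi>) \<phi> * (pmf p \<phi> * pmf \<rho> \<pi>))" for \<rho>
    unfolding f_avg_def
    by (subst integral_measure_pmf_real[of UNIV]) (auto simp: pmf_pair intro!: sum.cong)
  then have sum: "f_avg p f \<rho> = (\<Sum>\<pi>\<in>UNIV. \<Sum>\<phi>\<in>UNIV. f (selected \<pi> \<phi>) \<phi> * (pmf p \<phi> * pmf \<rho> \<pi>))"
    for \<rho>
    by (subst sum.swap) (simp add: sum.cartesian_product case_prod_beta)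
  have "f_avg p f (return_pmf \<pi>) = (\<Sum>\<phi>\<in>UNIV. f (selected \<pi> \<phi>) \<phi> * pmf p \<phi>)" for \<pi>
    unfolding f_avg_def
    by (subst pair_return_pmf2, subst integral_map_pmf, subst integral_measure_pmf_real[of UNIV]) auto
  then show ?thesis
    by (subst integral_measure_pmf_real[of UNIV])
      (auto simp: sum sum_distrib_right sum_distrib_left mult_ac)
qed

lemma optimal_policy_exists:
  fixes p :: "('e::finite, 'o::finite) realization pmf"
  assumes "independence_system \<I>"
  shows "\<exists>\<rho>. is_arg_max (f_avg p f) (\<lambda>\<rho>. \<rho> \<in> feasible_policies p \<I>) \<rho>"
proof -
  define D where "D = {\<pi>. return_pmf \<pi> \<in> feasible_policies p \<I>}"
  have idle: "(policy_step (\<lambda>_. None) \<phi> ^^ n) Map.empty = Map.empty"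
    for \<phi> :: "('e, 'o) realization" and n
    by (induction n) (auto simp: policy_step_def)
  have "(\<lambda>_. None) \<in> D"
    using assms by (auto simp: D_def feasible_policies_def selected_def idle independence_system_def)
  then have ne: "D \<noteq> {}" by blast
  have "finite D" by simp
  from finite_has_maximal[OF finite_imageI[OF this], of "\<lambda>\<pi>. f_avg p f (return_pmf \<pi>)"]
  obtain \<pi> where \<pi>: "\<pi> \<in> D"
    and max: "\<And>\<pi>'. \<pi>' \<in> D \<Longrightarrow> f_avg p f (return_pmf \<pi>') \<le> f_avg p f (return_pmf \<pi>)"
    using ne by (force simp: not_less)
  have "f_avg p f \<rho> \<le> f_avg p f (return_pmf \<pi>)" if "\<rho> \<in> feasible_policies p \<I>" for \<rho>
  proof -
    have "\<forall>\<pi>'\<in>set_pmf \<rho>. \<pi>' \<in> D"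
      using that by (auto simp: D_def feasible_policies_def)
    then have "AE \<pi>' in measure_pmf \<rho>. f_avg p f (return_pmf \<pi>') \<le> f_avg p f (return_pmf \<pi>)"
      using max by (auto simp: AE_measure_pmf_iff)
    then have "measure_pmf.expectation \<rho> (\<lambda>\<pi>'. f_avg p f (return_pmf \<pi>'))
        \<le> measure_pmf.expectation \<rho> (\<lambda>_. f_avg p f (return_pmf \<pi>))"
      by (intro integral_mono_AE) (auto intro: integrable_measure_pmf_finite)
    then show ?thesis by (simp add: f_avg_eq[of p f \<rho>])
  qed
  then show ?thesis
    using \<pi> by (intro exI[of _ "return_pmf \<pi>"]) (auto simp: is_arg_max_linorder D_def)
qed

end

theory Submission
  imports Defs
begin

text \<open>
  With both parameters \<open>1/2\<close> the policy is the greedy policy on a uniformly random set \<open>S\<close>; let \<open>G S\<close> be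
  the items it selects and \<open>T\<close> those of a feasible policy. The policies on \<open>S\<close> and \<open>- S\<close> select
  disjoint items, so by adaptive submodularity the values of \<open>T \<union> G S\<close> and \<open>T \<union> G (- S)\<close> add up to at
  least that of \<open>T\<close>; hence on average over \<open>S\<close> the value of \<open>T \<union> G S\<close> is at least half of that of \<open>T\<close>.
  Conversely, it exceeds the value of \<open>G S\<close> by at most the final marginals of the items in \<open>T - G S\<close>.
  If the greedy policy would not take such an item \<open>e\<close> even when run on \<open>insert e S\<close>, then greedy
  dominates \<open>e\<close> in every round in which \<open>e\<close> is feasible, and the \<open>k\<close>-system property bounds the total
  marginal of these items by \<open>k\<close> times the greedy gains. Otherwise \<open>e \<notin> S\<close>, and its marginal is at most
  what \<open>e\<close> contributes to the greedy run on \<open>insert e S\<close>; summed over all \<open>S\<close> and \<open>e \<notin> S\<close>, this is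
  at most all greedy gains once more. So half the value of \<open>T\<close> is at most \<open>k + 2\<close> times that of \<open>G S\<close>.
\<close>

no_notation Equipollence.lesspoll (infixl "\<prec>" 50)

section \<open>Expectations under probability mass functions\<close>

lemma integrable_finite_pmf [simp]:
  fixes p :: "'a::finite pmf" and h :: "'a \<Rightarrow> real"
  shows "integrable (measure_pmf p) h"
  by (rule integrable_measure_pmf_finite) simp

lemma expectation_mono:
  fixes p :: "'a::finite pmf" and g h :: "'a \<Rightarrow> real"
  assumes "\<And>x. x \<in> set_pmf p \<Longrightarrow> g x \<le> h x"
  shows "measure_pmf.expectation p g \<le> measure_pmf.expectation p h"
  using assms by (intro integral_mono_AE) (auto simp: AE_measure_pmf_iff)

lemma expectation_cong:
  fixes g h :: "'a \<Rightarrow> real"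
  assumes "\<And>x. x \<in> set_pmf p \<Longrightarrow> g x = h x"
  shows "measure_pmf.expectation p g = measure_pmf.expectation p h"
  using assms by (intro integral_cong_AE) (auto simp: AE_measure_pmf_iff)

section \<open>Adapted observations and conditioning on them\<close>

text \<open>Models what an adaptive procedure has observed when it stops, without naming the
  procedure. This covers the joint observations of several runs and makes the events
  \<open>\<Psi> \<phi> \<prec> \<phi>'\<close> the classes of a partition.\<close>

definition adapted :: "(('e, 'o) realization \<Rightarrow> ('e, 'o) partial) \<Rightarrow> bool" where
  "adapted \<Psi> \<longleftrightarrow> (\<forall>\<phi>. \<Psi> \<phi> \<prec> \<phi>) \<and> (\<forall>\<phi> \<phi>'. \<Psi> \<phi> \<prec> \<phi>' \<longrightarrow> \<Psi> \<phi>' = \<Psi> \<phi>)"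

lemma adaptedD:
  assumes "adapted \<Psi>"
  shows "\<Psi> \<phi> \<prec> \<phi>" "\<Psi> \<phi> \<prec> \<phi>' \<Longrightarrow> \<Psi> \<phi>' = \<Psi> \<phi>"
  using assms unfolding adapted_def by blast+

lemma adapted_consistent_iff:
  assumes "adapted \<Psi>"
  shows "\<Psi> \<phi> \<prec> \<phi>' \<longleftrightarrow> \<Psi> \<phi>' = \<Psi> \<phi>"
  using adaptedD[OF assms] by metis

text \<open>The tower property: the events conditioned on form a partition, so drawing \<phi> and
  then redrawing within its class gives back \<open>p\<close>.\<close>

lemma expectation_cond_adapted:
  fixes p :: "('e::finite, 'o::finite) realization pmf" and h :: "('e, 'o) realization \<Rightarrow> real"
  assumes "adapted \<Psi>"
  shows "measure_pmf.expectation p (\<lambda>\<phi>. measure_pmf.expectation (cond_pmf p {\<phi>'. \<Psi> \<phi> \<prec> \<phi>'}) h)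
    = measure_pmf.expectation p h"
proof -
  note iff = adapted_consistent_iff[OF assms]
  have "p = bind_pmf p (\<lambda>\<phi>. cond_pmf p {\<phi>'. \<Psi> \<phi> \<prec> \<phi>'})"
  proof (rule sym, rule bind_cond_pmf_cancel[where R = "\<lambda>\<phi> \<phi>'. \<Psi> \<phi> \<prec> \<phi>'"])
    fix \<phi> \<phi>' assume "\<Psi> \<phi> \<prec> \<phi>'"
    then have "{y. \<Psi> \<phi> \<prec> y} = {x. \<Psi> x \<prec> \<phi>'}" by (auto simp: iff)
    then show "measure p {y. \<Psi> \<phi> \<prec> y} = measure p {x. \<Psi> x \<prec> \<phi>'}" by simp
  qed (auto simp: iff)
  then have "measure_pmf.expectation p h
      = measure_pmf.expectation (bind_pmf p (\<lambda>\<phi>. cond_pmf p {\<phi>'. \<Psi> \<phi> \<prec> \<phi>'})) h"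
    by simp
  also have "\<dots> = measure_pmf.expectation p (\<lambda>\<phi>. measure_pmf.expectation (cond_pmf p {\<phi>'. \<Psi> \<phi> \<prec> \<phi>'}) h)"
    by (subst pmf_expectation_bind[where A = UNIV], simp_all)
      (subst integral_measure_pmf_real[of UNIV], simp_all add: mult.commute)
  finally show ?thesis by simp
qed

text \<open>\<open>++\<close> prefers its right argument, but both arguments agree with the same
  \<phi>, so no entry of the left one changes its value.\<close>

lemma consistent_le_union:
  assumes "\<psi> \<prec> \<phi>" "\<psi>' \<prec> \<phi>"
  shows "\<psi> \<subseteq>\<^sub>m \<psi> ++ \<psi>'"
  unfolding map_le_def
proof
  fix x assume "x \<in> dom \<psi>"
  then have "\<psi> x = Some (\<phi> x)"
    using assms(1) by (simp add: consistent_def map_le_def)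
  moreover have "\<psi>' x = None \<or> \<psi>' x = Some (\<phi> x)"
    using assms(2) by (cases "\<psi>' x") (auto simp: consistent_def map_le_def dom_def)
  ultimately show "\<psi> x = (\<psi> ++ \<psi>') x"
    by (auto simp: map_add_def)
qed

lemma consistent_union:
  assumes "\<psi> \<prec> \<phi>" "\<psi>' \<prec> \<phi>"
  shows "(\<psi> ++ \<psi>') \<prec> \<phi>' \<longleftrightarrow> \<psi> \<prec> \<phi>' \<and> \<psi>' \<prec> \<phi>'"
  using consistent_le_union[OF assms] map_le_map_add[of \<psi>' \<psi>]
  unfolding consistent_def by (blast intro: map_le_trans map_add_le_mapI)

lemma adapted_union:
  assumes "adapted \<Psi>" "adapted \<Psi>'"
  shows "adapted (\<lambda>\<phi>. \<Psi> \<phi> ++ \<Psi>' \<phi>)"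
proof -
  note iff = consistent_union[OF adaptedD(1)[OF assms(1)] adaptedD(1)[OF assms(2)]]
  have "\<Psi> \<phi>' ++ \<Psi>' \<phi>' = \<Psi> \<phi> ++ \<Psi>' \<phi>" if "(\<Psi> \<phi> ++ \<Psi>' \<phi>) \<prec> \<phi>'" for \<phi> \<phi>'
  proof -
    from that have "\<Psi> \<phi>' = \<Psi> \<phi>" "\<Psi>' \<phi>' = \<Psi>' \<phi>"
      unfolding iff by (auto intro: adaptedD(2)[OF assms(1)] adaptedD(2)[OF assms(2)])
    then show ?thesis by simp
  qed
  moreover have "(\<Psi> \<phi> ++ \<Psi>' \<phi>) \<prec> \<phi>" for \<phi>
    unfolding iff using adaptedD(1)[OF assms(1)] adaptedD(1)[OF assms(2)] by blast
  ultimately show ?thesis unfolding adapted_def by blast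
qed

section \<open>Conditional gain of a single round\<close>

definition gain ::
    "('e, 'o) realization pmf \<Rightarrow> ('e, 'o) utility \<Rightarrow> ('e, 'o) partial \<Rightarrow> 'e option \<Rightarrow> real" where
  "gain p f \<psi> x = (case x of None \<Rightarrow> 0 | Some e \<Rightarrow> marginal p f e \<psi>)"

lemma gain_simps [simp]: "gain p f \<psi> None = 0" "gain p f \<psi> (Some e) = marginal p f e \<psi>"
  by (simp_all add: gain_def)

lemma marginal_dom: "e \<in> dom \<psi> \<Longrightarrow> marginal p f e \<psi> = 0"
  by (simp add: marginal_def insert_absorb)

text \<open>By the tower property: observations and choice are constant on each class of compatible
  realizations, so conditioning the true increment on the class gives the marginal.\<close>

lemma expectation_gain:
  fixes p :: "('e::finite, 'o::finite) realization pmf"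
  assumes "adapted \<Psi>" and c: "\<And>\<phi> \<phi>'. \<Psi> \<phi> \<prec> \<phi>' \<Longrightarrow> c \<phi>' = c \<phi>"
  shows "measure_pmf.expectation p (\<lambda>\<phi>. gain p f (\<Psi> \<phi>) (c \<phi>)) =
    measure_pmf.expectation p (\<lambda>\<phi>. f (dom (\<Psi> \<phi>) \<union> set_option (c \<phi>)) \<phi> - f (dom (\<Psi> \<phi>)) \<phi>)"
    (is "_ = measure_pmf.expectation p ?h")
proof -
  have "gain p f (\<Psi> \<phi>) (c \<phi>) = measure_pmf.expectation (cond_pmf p {\<phi>'. \<Psi> \<phi> \<prec> \<phi>'}) ?h"
    if "\<phi> \<in> set_pmf p" for \<phi>
  proof -
    have ne: "set_pmf p \<inter> {\<phi>'. \<Psi> \<phi> \<prec> \<phi>'} \<noteq> {}"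
      using that adaptedD(1)[OF assms(1)] by auto
    have "measure_pmf.expectation (cond_pmf p {\<phi>'. \<Psi> \<phi> \<prec> \<phi>'}) ?h
      = measure_pmf.expectation (cond_pmf p {\<phi>'. \<Psi> \<phi> \<prec> \<phi>'})
        (\<lambda>\<phi>'. f (dom (\<Psi> \<phi>) \<union> set_option (c \<phi>)) \<phi>' - f (dom (\<Psi> \<phi>)) \<phi>')"
      using c adaptedD(2)[OF assms(1)] by (intro expectation_cong) (auto simp: set_cond_pmf[OF ne])
    then show ?thesis
      by (auto simp: gain_def marginal_def split: option.splits)
  qed
  then have "measure_pmf.expectation p (\<lambda>\<phi>. gain p f (\<Psi> \<phi>) (c \<phi>)) =
      measure_pmf.expectation p (\<lambda>\<phi>. measure_pmf.expectation (cond_pmf p {\<phi>'. \<Psi> \<phi> \<prec> \<phi>'}) ?h)"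
    by (rule expectation_cong)
  also have "\<dots> = measure_pmf.expectation p ?h"
    by (rule expectation_cond_adapted[OF assms(1)])
  finally show ?thesis .
qed

section \<open>Runs of deterministic policies, round by round\<close>

definition run :: "('e, 'o) det_policy \<Rightarrow> nat \<Rightarrow> ('e, 'o) realization \<Rightarrow> ('e, 'o) partial" where
  "run \<pi> n \<phi> = (policy_step \<pi> \<phi> ^^ n) Map.empty"

lemma run_0 [simp]: "run \<pi> 0 \<phi> = Map.empty"
  and run_Suc: "run \<pi> (Suc n) \<phi> = policy_step \<pi> \<phi> (run \<pi> n \<phi>)"
  by (simp_all add: run_def)

lemma selected_run: "selected \<pi> \<phi> = dom (run \<pi> CARD('e) \<phi>)" for \<pi> :: "('e::finite, 'o) det_policy"
  by (simp add: selected_def run_def)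

lemma dom_run_Suc: "dom (run \<pi> (Suc n) \<phi>) = dom (run \<pi> n \<phi>) \<union> set_option (\<pi> (run \<pi> n \<phi>))"
  by (auto simp: run_Suc policy_step_def split: option.splits)

lemma run_consistent: "run \<pi> n \<phi> \<prec> \<phi>"
  by (induction n) (auto simp: run_Suc consistent_def policy_step_def map_le_def split: option.splits)

lemma run_le_Suc: "run \<pi> n \<phi> \<subseteq>\<^sub>m run \<pi> (Suc n) \<phi>"
  using run_consistent[of \<pi> n \<phi>]
  by (auto simp: run_Suc consistent_def policy_step_def map_le_def split: option.splits)

lemma run_mono: "i \<le> j \<Longrightarrow> run \<pi> i \<phi> \<subseteq>\<^sub>m run \<pi> j \<phi>"
  by (induction j rule: dec_induct) (auto intro: map_le_trans run_le_Suc)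

text \<open>A compatible realization produces the same first \<open>n\<close> rounds by induction,
  hence the same next item, whose state is recorded and so agrees as well.\<close>

lemma adapted_run: "adapted (run \<pi> n)"
proof -
  have "run \<pi> n \<phi>' = run \<pi> n \<phi>" if "run \<pi> n \<phi> \<prec> \<phi>'" for \<phi> \<phi>'
    using that
  proof (induction n)
    case (Suc n)
    have "run \<pi> n \<phi> \<prec> \<phi>'"
      using Suc.prems run_le_Suc[of \<pi> n \<phi>] unfolding consistent_def by (blast intro: map_le_trans)
    then have IH: "run \<pi> n \<phi>' = run \<pi> n \<phi>" by (rule Suc.IH)
    show ?case
    proof (cases "\<pi> (run \<pi> n \<phi>)")
      case (Some e)
      then have "\<phi>' e = \<phi> e"
        using Suc.prems unfolding run_Suc policy_step_def consistent_def map_le_def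
        by (auto dest: bspec[of _ _ e])
      then show ?thesis by (simp add: run_Suc IH policy_step_def Some)
    qed (simp add: run_Suc IH policy_step_def)
  qed simp
  then show ?thesis by (auto simp: adapted_def run_consistent)
qed

text \<open>Here \<pi> is run afresh and decides on its own observations alone, while gains are
  conditioned on \<open>\<Psi> \<phi>\<close> too. Each increment is given by
  \<open>expectation_gain\<close>.\<close>

lemma expectation_telescope:
  fixes p :: "('e::finite, 'o::finite) realization pmf"
  assumes "adapted \<Psi>"
  shows "measure_pmf.expectation p (\<lambda>\<phi>. f (dom (\<Psi> \<phi>) \<union> dom (run \<pi> n \<phi>)) \<phi>) =
    measure_pmf.expectation p (\<lambda>\<phi>. f (dom (\<Psi> \<phi>)) \<phi>) +
    measure_pmf.expectation p (\<lambda>\<phi>. \<Sum>i<n. gain p f (\<Psi> \<phi> ++ run \<pi> i \<phi>) (\<pi> (run \<pi> i \<phi>)))"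
proof (induction n)
  case (Suc n)
  have "measure_pmf.expectation p (\<lambda>\<phi>. gain p f (\<Psi> \<phi> ++ run \<pi> n \<phi>) (\<pi> (run \<pi> n \<phi>))) =
    measure_pmf.expectation p (\<lambda>\<phi>. f (dom (\<Psi> \<phi> ++ run \<pi> n \<phi>) \<union> set_option (\<pi> (run \<pi> n \<phi>))) \<phi>
      - f (dom (\<Psi> \<phi> ++ run \<pi> n \<phi>)) \<phi>)"
  proof (rule expectation_gain)
    fix \<phi> \<phi>' assume "(\<Psi> \<phi> ++ run \<pi> n \<phi>) \<prec> \<phi>'"
    then have "run \<pi> n \<phi> \<prec> \<phi>'"
      using consistent_union[OF adaptedD(1)[OF assms] run_consistent] by blast
    then show "\<pi> (run \<pi> n \<phi>') = \<pi> (run \<pi> n \<phi>)"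
      using adaptedD(2)[OF adapted_run] by metis
  qed (intro adapted_union assms adapted_run)
  then show ?case
    using Suc.IH by (simp add: dom_run_Suc Un_ac)
qed simp

section \<open>Adaptive submodularity for whole runs\<close>

lemma consistent_observable: "\<phi> \<in> set_pmf p \<Longrightarrow> \<psi> \<prec> \<phi> \<Longrightarrow> observable p \<psi>"
  by (auto simp: observable_def)

lemma adaptive_submodularD:
  assumes "adaptive_submodular p f" "\<phi> \<in> set_pmf p" "\<psi>' \<prec> \<phi>" "\<psi> \<subseteq>\<^sub>m \<psi>'" "e \<notin> dom \<psi>'"
  shows "marginal p f e \<psi>' \<le> marginal p f e \<psi>"
  using assms consistent_observable unfolding adaptive_submodular_def by blast

lemma union_mono:
  assumes "\<psi> \<subseteq>\<^sub>m \<psi>'" "\<psi>' \<prec> \<phi>" "\<psi>'' \<prec> \<phi>"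
  shows "\<psi> ++ \<psi>'' \<subseteq>\<^sub>m \<psi>' ++ \<psi>''"
  using assms by (auto simp: map_le_def map_add_def dom_def split: option.splits)

text \<open>Diminishing returns, round by round in the telescoped sums. Marginals may be negative,
  hence \<open>disj\<close>: an item of \<open>\<Psi>' \<phi>\<close> gains 0 on the left, which
  could exceed its gain on the right unless it lies in \<open>\<Psi> \<phi>\<close> too.\<close>

lemma expectation_extension_antimono:
  fixes p :: "('e::finite, 'o::finite) realization pmf"
  assumes sub: "adaptive_submodular p f"
    and ad: "adapted \<Psi>" "adapted \<Psi>'"
    and le: "\<And>\<phi>. \<Psi> \<phi> \<subseteq>\<^sub>m \<Psi>' \<phi>"
    and disj: "\<And>\<phi>. dom (run \<pi> n \<phi>) \<inter> dom (\<Psi>' \<phi>) \<subseteq> dom (\<Psi> \<phi>)"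
  shows "measure_pmf.expectation p (\<lambda>\<phi>. f (dom (\<Psi>' \<phi>) \<union> dom (run \<pi> n \<phi>)) \<phi>)
      - measure_pmf.expectation p (\<lambda>\<phi>. f (dom (\<Psi>' \<phi>)) \<phi>)
    \<le> measure_pmf.expectation p (\<lambda>\<phi>. f (dom (\<Psi> \<phi>) \<union> dom (run \<pi> n \<phi>)) \<phi>)
      - measure_pmf.expectation p (\<lambda>\<phi>. f (dom (\<Psi> \<phi>)) \<phi>)"
proof -
  have "gain p f (\<Psi>' \<phi> ++ run \<pi> i \<phi>) (\<pi> (run \<pi> i \<phi>)) \<le> gain p f (\<Psi> \<phi> ++ run \<pi> i \<phi>) (\<pi> (run \<pi> i \<phi>))"
    if "\<phi> \<in> set_pmf p" "i < n" for \<phi> i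
  proof (cases "\<pi> (run \<pi> i \<phi>)")
    case (Some e)
    have "dom (run \<pi> (Suc i) \<phi>) \<subseteq> dom (run \<pi> n \<phi>)"
      using that(2) by (intro map_le_implies_dom_le run_mono) simp
    with Some disj[of \<phi>] have e: "e \<in> dom (\<Psi>' \<phi>) \<Longrightarrow> e \<in> dom (\<Psi> \<phi>)"
      by (auto simp: dom_run_Suc)
    have cons: "(\<Psi>' \<phi> ++ run \<pi> i \<phi>) \<prec> \<phi>"
      using consistent_union[OF adaptedD(1)[OF ad(2)] run_consistent] adaptedD(1)[OF ad(2)] run_consistent by blast
    show ?thesis
    proof (cases "e \<in> dom (\<Psi>' \<phi> ++ run \<pi> i \<phi>)")
      case True
      with e have "e \<in> dom (\<Psi> \<phi> ++ run \<pi> i \<phi>)" by auto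
      with True show ?thesis by (simp only: Some gain_simps marginal_dom)
    next
      case False
      have "\<Psi> \<phi> ++ run \<pi> i \<phi> \<subseteq>\<^sub>m \<Psi>' \<phi> ++ run \<pi> i \<phi>"
        using union_mono[OF le adaptedD(1)[OF ad(2)] run_consistent] .
      then show ?thesis
        using adaptive_submodularD[OF sub that(1) cons _ False] Some by simp
    qed
  qed simp
  then have "measure_pmf.expectation p (\<lambda>\<phi>. \<Sum>i<n. gain p f (\<Psi>' \<phi> ++ run \<pi> i \<phi>) (\<pi> (run \<pi> i \<phi>)))
    \<le> measure_pmf.expectation p (\<lambda>\<phi>. \<Sum>i<n. gain p f (\<Psi> \<phi> ++ run \<pi> i \<phi>) (\<pi> (run \<pi> i \<phi>)))"
    by (intro expectation_mono sum_mono) simp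
  then show ?thesis
    by (simp add: expectation_telescope ad)
qed

text \<open>In the telescoped sum, adaptive submodularity lets the run's own observations be
  dropped, so a new item counts at most its marginal given \<open>\<Psi> \<phi>\<close>.\<close>

lemma expectation_extension_le:
  fixes p :: "('e::finite, 'o::finite) realization pmf"
  assumes sub: "adaptive_submodular p f" and ad: "adapted \<Psi>"
  shows "measure_pmf.expectation p (\<lambda>\<phi>. f (dom (\<Psi> \<phi>) \<union> dom (run \<pi> n \<phi>)) \<phi>)
    \<le> measure_pmf.expectation p (\<lambda>\<phi>. f (dom (\<Psi> \<phi>)) \<phi>)
      + measure_pmf.expectation p (\<lambda>\<phi>. \<Sum>e\<in>dom (run \<pi> n \<phi>) - dom (\<Psi> \<phi>). marginal p f e (\<Psi> \<phi>))"
proof -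
  have "(\<Sum>i<n. gain p f (\<Psi> \<phi> ++ run \<pi> i \<phi>) (\<pi> (run \<pi> i \<phi>)))
    \<le> (\<Sum>e\<in>dom (run \<pi> n \<phi>) - dom (\<Psi> \<phi>). marginal p f e (\<Psi> \<phi>))"
    if \<phi>: "\<phi> \<in> set_pmf p" for \<phi>
  proof (induction n)
    case (Suc n)
    let ?\<psi> = "\<Psi> \<phi> ++ run \<pi> n \<phi>"
    have cons: "?\<psi> \<prec> \<phi>"
      using consistent_union[OF adaptedD(1)[OF ad] run_consistent] adaptedD(1)[OF ad] run_consistent by blast
    have le: "\<Psi> \<phi> \<subseteq>\<^sub>m ?\<psi>"
      by (rule consistent_le_union[OF adaptedD(1)[OF ad] run_consistent])
    consider "set_option (\<pi> (run \<pi> n \<phi>)) \<subseteq> dom ?\<psi>"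
      | e where "\<pi> (run \<pi> n \<phi>) = Some e" "e \<notin> dom ?\<psi>"
      by (cases "\<pi> (run \<pi> n \<phi>)") auto
    then show ?case
    proof cases
      case 1
      then have "gain p f ?\<psi> (\<pi> (run \<pi> n \<phi>)) = 0"
        using marginal_dom[of _ ?\<psi> p f] by (cases "\<pi> (run \<pi> n \<phi>)") simp_all
      moreover have "dom (run \<pi> (Suc n) \<phi>) - dom (\<Psi> \<phi>) = dom (run \<pi> n \<phi>) - dom (\<Psi> \<phi>)"
        using 1 by (auto simp: dom_run_Suc)
      ultimately show ?thesis using Suc.IH by simp
    next
      case 2
      have "dom (run \<pi> (Suc n) \<phi>) - dom (\<Psi> \<phi>) = insert e (dom (run \<pi> n \<phi>) - dom (\<Psi> \<phi>))"
        using 2 by (auto simp: dom_run_Suc)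
      then show ?thesis
        using Suc.IH 2 adaptive_submodularD[OF sub \<phi> cons le 2(2)] by simp
    qed
  qed simp
  then have "measure_pmf.expectation p (\<lambda>\<phi>. \<Sum>i<n. gain p f (\<Psi> \<phi> ++ run \<pi> i \<phi>) (\<pi> (run \<pi> i \<phi>)))
    \<le> measure_pmf.expectation p (\<lambda>\<phi>. \<Sum>e\<in>dom (run \<pi> n \<phi>) - dom (\<Psi> \<phi>). marginal p f e (\<Psi> \<phi>))"
    by (intro expectation_mono)
  then show ?thesis
    by (simp add: expectation_telescope ad)
qed

lemma expectation_union_disjoint:
  fixes p :: "('e::finite, 'o::finite) realization pmf"
  assumes nonneg: "\<And>S \<phi>. f S \<phi> \<ge> 0" and sub: "adaptive_submodular p f"
    and disj: "\<And>\<phi>. dom (run \<pi>\<^sub>1 n \<phi>) \<inter> dom (run \<pi>\<^sub>2 n \<phi>) = {}"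
  shows "measure_pmf.expectation p (\<lambda>\<phi>. f (dom (run \<pi> n \<phi>)) \<phi>)
    \<le> measure_pmf.expectation p (\<lambda>\<phi>. f (dom (run \<pi> n \<phi>) \<union> dom (run \<pi>\<^sub>1 n \<phi>)) \<phi>)
      + measure_pmf.expectation p (\<lambda>\<phi>. f (dom (run \<pi> n \<phi>) \<union> dom (run \<pi>\<^sub>2 n \<phi>)) \<phi>)"
proof -
  let ?\<Psi>' = "\<lambda>\<phi>. run \<pi> n \<phi> ++ run \<pi>\<^sub>1 n \<phi>"
  have "run \<pi> n \<phi> \<subseteq>\<^sub>m ?\<Psi>' \<phi>" for \<phi>
    by (rule consistent_le_union[OF run_consistent run_consistent])
  moreover have "dom (run \<pi>\<^sub>2 n \<phi>) \<inter> dom (?\<Psi>' \<phi>) \<subseteq> dom (run \<pi> n \<phi>)" for \<phi>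
    using disj[of \<phi>] by auto
  ultimately have "measure_pmf.expectation p (\<lambda>\<phi>. f (dom (?\<Psi>' \<phi>) \<union> dom (run \<pi>\<^sub>2 n \<phi>)) \<phi>)
      - measure_pmf.expectation p (\<lambda>\<phi>. f (dom (?\<Psi>' \<phi>)) \<phi>)
    \<le> measure_pmf.expectation p (\<lambda>\<phi>. f (dom (run \<pi> n \<phi>) \<union> dom (run \<pi>\<^sub>2 n \<phi>)) \<phi>)
      - measure_pmf.expectation p (\<lambda>\<phi>. f (dom (run \<pi> n \<phi>)) \<phi>)"
    by (intro expectation_extension_antimono sub adapted_run adapted_union)
  moreover have "measure_pmf.expectation p (\<lambda>\<phi>. f (dom (?\<Psi>' \<phi>) \<union> dom (run \<pi>\<^sub>2 n \<phi>)) \<phi>) \<ge> 0"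
    by (intro integral_nonneg_AE) (simp add: nonneg)
  ultimately show ?thesis
    by (simp add: Un_commute)
qed


section \<open>Counting in k-systems and charging\<close>

text \<open>Compare two bases of \<open>G \<union> X\<close>: by saturation \<open>G\<close> is one,
  and \<open>X\<close> extends to another.\<close>

lemma k_system_card_le:
  fixes \<I> :: "'e::finite set set"
  assumes k: "k_system k \<I>" and G: "G \<in> \<I>" and X: "X \<in> \<I>"
    and sat: "\<And>e. e \<in> X \<Longrightarrow> insert e G \<notin> \<I>"
  shows "card X \<le> k * card G"
proof -
  have sub: "\<And>A B. A \<in> \<I> \<Longrightarrow> B \<subseteq> A \<Longrightarrow> B \<in> \<I>"
    using k by (auto simp: k_system_def independence_system_def)
  have "G \<in> bases \<I> (G \<union> X)"
  proof -
    have "B = G" if B: "B \<in> \<I>" "G \<subseteq> B" "B \<subseteq> G \<union> X" for B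
    proof (rule ccontr)
      assume "B \<noteq> G"
      then obtain e where "e \<in> B" "e \<in> X" using B by blast
      with B(2) have "insert e G \<subseteq> B" by blast
      with sub[OF B(1)] sat[OF \<open>e \<in> X\<close>] show False by blast
    qed
    with G show ?thesis by (auto simp: bases_def)
  qed
  then have Min: "Min (card ` bases \<I> (G \<union> X)) \<le> card G"
    by (intro Min_le) auto
  define Z where "Z = {B \<in> \<I>. X \<subseteq> B \<and> B \<subseteq> G \<union> X}"
  have "finite Z" "Z \<noteq> {}" using X by (auto simp: Z_def)
  from finite_has_maximal[OF this] obtain B
    where B: "B \<in> Z" and max: "\<And>C. C \<in> Z \<Longrightarrow> B \<subseteq> C \<Longrightarrow> B = C"
    by blast
  have "C = B" if "C \<in> \<I>" "B \<subseteq> C" "C \<subseteq> G \<union> X" for C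
    using that B max[of C] by (auto simp: Z_def)
  with B have "B \<in> bases \<I> (G \<union> X)"
    by (auto simp: bases_def Z_def)
  then have "card B \<le> Max (card ` bases \<I> (G \<union> X))"
    by (intro Max_ge) auto
  moreover have "card X \<le> card B"
    using B by (intro card_mono) (auto simp: Z_def)
  moreover have "Max (card ` bases \<I> (G \<union> X)) \<le> k * Min (card ` bases \<I> (G \<union> X))"
    using k by (simp add: k_system_def)
  ultimately show ?thesis
    using mult_le_mono2[OF Min, of k] by linarith
qed

text \<open>
  The term \<open>(k * n - card (X n)) * d n\<close> is the slack that keeps the induction going: it is what
  can still be charged to the first \<open>n\<close> rounds.
\<close>

lemma sum_le_antimono_charging:
  fixes w :: "'a \<Rightarrow> real" and d :: "nat \<Rightarrow> real" and X :: "nat \<Rightarrow> 'a set"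
  assumes fin: "\<And>i. finite (X i)" and "X 0 = {}" and mono: "\<And>i. X i \<subseteq> X (Suc i)"
    and card: "\<And>i. card (X i) \<le> k * i"
    and w: "\<And>i e. i < n \<Longrightarrow> e \<in> X (Suc i) - X i \<Longrightarrow> w e \<le> d i"
    and d: "\<And>i. d (Suc i) \<le> d i" "d n \<ge> 0"
  shows "(\<Sum>e\<in>X n. w e) \<le> real k * (\<Sum>i<n. d i)"
proof -
  have "(\<Sum>e\<in>X m. w e) + (real k * real m - real (card (X m))) * d m \<le> real k * (\<Sum>i<m. d i)"
    if "m \<le> n" for m
    using that
  proof (induction m)
    case (Suc m)
    have le: "real (card (X (Suc m))) \<le> real k * real (Suc m)"
      using card[of "Suc m"] unfolding of_nat_mult[symmetric] of_nat_le_iff .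
    have "(\<Sum>e\<in>X (Suc m) - X m. w e) \<le> (\<Sum>e\<in>X (Suc m) - X m. d m)"
      using Suc.prems by (intro sum_mono w) auto
    also have "\<dots> = (real (card (X (Suc m))) - real (card (X m))) * d m"
      using mono[of m] fin by (simp add: card_Diff_subset of_nat_diff card_mono)
    finally have "(\<Sum>e\<in>X (Suc m). w e)
        \<le> (\<Sum>e\<in>X m. w e) + (real (card (X (Suc m))) - real (card (X m))) * d m"
      using sum.subset_diff[OF mono[of m] fin, of w] by linarith
    \<comment> \<open>The bound on \<open>card\<close> makes the first factor nonnegative, so the
      slack loses value as \<open>d\<close> decreases.\<close>
    moreover have "(real k * real (Suc m) - real (card (X (Suc m)))) * d (Suc m)
        \<le> (real k * real (Suc m) - real (card (X (Suc m)))) * d m"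
      using le d(1) by (intro mult_left_mono) auto
    ultimately show ?case
      using Suc.IH Suc.prems by (simp add: algebra_simps)
  qed (simp add: assms)
  from this[of n] have "(\<Sum>e\<in>X n. w e) + (real k * real n - real (card (X n))) * d n
      \<le> real k * (\<Sum>i<n. d i)"
    by simp
  moreover have "(real k * real n - real (card (X n))) * d n \<ge> 0"
    using card[of n] d(2) unfolding of_nat_mult[symmetric]
    by (intro mult_nonneg_nonneg) (simp_all del: of_nat_mult)
  ultimately show ?thesis by linarith
qed

section \<open>Sampling with fair coins\<close>

lemma f_avg_return:
  fixes p :: "('e::finite, 'o::finite) realization pmf"
  shows "f_avg p f (return_pmf \<pi>) = measure_pmf.expectation p (\<lambda>\<phi>. f (dom (run \<pi> CARD('e) \<phi>)) \<phi>)"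
  unfolding f_avg_def by (subst pair_return_pmf2, subst integral_map_pmf) (simp add: selected_run)

text \<open>A fair sample and its complement are both uniformly distributed over all sets, so either
  outcome of the second coin leads to the same distribution.\<close>

lemma sag_policy_half:
  fixes p :: "('e::finite, 'o::finite) realization pmf"
  shows "sag_policy (1/2) (1/2) p f \<I> rk = map_pmf (greedy_policy p f \<I> rk) (pmf_of_set UNIV)"
proof -
  have "PiE_dflt (UNIV :: 'e set) False (\<lambda>_. UNIV) = UNIV"
    by (auto simp: PiE_dflt_def)
  then have Pi: "Pi_pmf (UNIV :: 'e set) False (\<lambda>_. bernoulli_pmf (1/2)) = pmf_of_set UNIV"
    by (simp add: bernoulli_pmf_half_conv_pmf_of_set Pi_pmf_of_set)
  have "map_pmf (\<lambda>x :: 'e \<Rightarrow> bool. if b then {e. x e} else {e. \<not> x e}) (pmf_of_set UNIV) = pmf_of_set UNIV"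
    for b
    by (intro map_pmf_of_set_bij_betw bij_betwI[where g = "\<lambda>S e. if b then e \<in> S else e \<notin> S"]) auto
  then have "map_pmf (\<lambda>x. greedy_policy p f \<I> rk (if b then {e. x e} else {e. \<not> x e})) (pmf_of_set UNIV)
      = map_pmf (greedy_policy p f \<I> rk) (pmf_of_set UNIV)" for b
    by (metis (no_types, lifting) map_pmf_comp map_pmf_cong)
  then show ?thesis
    unfolding sag_policy_def Pi Let_def
    by (subst bind_commute_pmf) (simp add: map_pmf_def[symmetric])
qed

section \<open>Choices of the greedy policy\<close>

locale adaptive_greedy =
  fixes p :: "('e::finite, 'o::finite) realization pmf"
    and f :: "('e, 'o) utility"
    and \<I> :: "'e set set"
    and k :: nat
    and rk :: "('e, 'o) partial \<Rightarrow> 'e \<Rightarrow> nat"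
  assumes nonneg: "\<And>S \<phi>. f S \<phi> \<ge> 0"
    and sub: "adaptive_submodular p f"
    and k_system: "k_system k \<I>"
    and inj_rk: "\<And>\<psi>. inj (rk \<psi>)"
begin

abbreviation greedy :: "'e set \<Rightarrow> ('e, 'o) det_policy" where
  "greedy S \<equiv> greedy_policy p f \<I> rk S"

abbreviation candidates :: "'e set \<Rightarrow> ('e, 'o) partial \<Rightarrow> 'e set" where
  "candidates S \<psi> \<equiv> greedy_candidates p f \<I> S \<psi>"

abbreviation greedy_gain :: "'e set \<Rightarrow> ('e, 'o) partial \<Rightarrow> real" where
  "greedy_gain S \<psi> \<equiv> gain p f \<psi> (greedy S \<psi>)"

lemma empty_indep: "{} \<in> \<I>"
  and indep_subset: "A \<in> \<I> \<Longrightarrow> B \<subseteq> A \<Longrightarrow> B \<in> \<I>"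
  using k_system by (auto simp: k_system_def independence_system_def)

lemma greedy_None_iff: "greedy S \<psi> = None \<longleftrightarrow> candidates S \<psi> = {}"
  by (simp add: greedy_policy_def Let_def)

text \<open>Larger marginal first, then smaller rank: the first candidate is unique because
  \<open>rk \<psi>\<close> is injective. Phrased by pairwise comparisons, the choice carries over
  between different sets \<open>S\<close>.\<close>

lemma greedy_Some_iff:
  "greedy S \<psi> = Some e \<longleftrightarrow> e \<in> candidates S \<psi> \<and>
     (\<forall>e'\<in>candidates S \<psi>. marginal p f e' \<psi> \<le> marginal p f e \<psi> \<and>
        (marginal p f e' \<psi> = marginal p f e \<psi> \<longrightarrow> rk \<psi> e \<le> rk \<psi> e'))"
  (is "_ \<longleftrightarrow> ?first e")
proof -
  let ?F = "candidates S \<psi>"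
  let ?M = "{e \<in> ?F. \<forall>e'\<in>?F. marginal p f e' \<psi> \<le> marginal p f e \<psi>}"
  have *: "?first (arg_min_on (rk \<psi>) ?M)" if "?F \<noteq> {}"
  proof -
    have "Max ((\<lambda>e. marginal p f e \<psi>) ` ?F) \<in> (\<lambda>e. marginal p f e \<psi>) ` ?F"
      using that by (intro Max_in) auto
    then obtain m where m: "m \<in> ?F" "marginal p f m \<psi> = Max ((\<lambda>e. marginal p f e \<psi>) ` ?F)"
      by auto
    then have "\<forall>e'\<in>?F. marginal p f e' \<psi> \<le> marginal p f m \<psi>"
      by simp
    with m have M: "?M \<noteq> {}" by blast
    have "arg_min_on (rk \<psi>) ?M \<in> ?M"
      by (rule arg_min_if_finite(1)[OF _ M]) simp
    moreover have "rk \<psi> (arg_min_on (rk \<psi>) ?M) \<le> rk \<psi> e'" if "e' \<in> ?M" for e'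
      by (rule arg_min_least[OF _ M that]) simp
    ultimately show ?thesis by auto
  qed
  have unique: "e = e'" if "?first e" "?first e'" for e e'
  proof -
    have "rk \<psi> e = rk \<psi> e'" using that by (meson antisym)
    with inj_rk show ?thesis by (auto dest: injD)
  qed
  show ?thesis
  proof (cases "?F = {}")
    case False
    then have "greedy S \<psi> = Some (arg_min_on (rk \<psi>) ?M)"
      by (simp add: greedy_policy_def Let_def)
    moreover have "?first e \<longleftrightarrow> arg_min_on (rk \<psi>) ?M = e"
    proof
      assume "?first e"
      with *[OF False] show "arg_min_on (rk \<psi>) ?M = e" by (rule unique)
    next
      assume "arg_min_on (rk \<psi>) ?M = e"
      with *[OF False] show "?first e" by (rule back_subst[of ?first])
    qed
    ultimately show ?thesis by (simp only: option.inject)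
  qed (simp add: greedy_policy_def)
qed

lemma greedy_SomeD:
  assumes "greedy S \<psi> = Some e"
  shows "e \<in> S" "e \<notin> dom \<psi>" "insert e (dom \<psi>) \<in> \<I>" "marginal p f e \<psi> > 0"
  using assms by (auto simp: greedy_Some_iff greedy_candidates_def)

lemma greedy_gain_nonneg: "greedy_gain S \<psi> \<ge> 0"
  by (cases "greedy S \<psi>") (auto dest: greedy_SomeD(4))

lemma marginal_le_greedy_gain:
  assumes "e \<in> S" "e \<notin> dom \<psi>" "insert e (dom \<psi>) \<in> \<I>"
  shows "marginal p f e \<psi> \<le> greedy_gain S \<psi>"
proof (cases "marginal p f e \<psi> > 0")
  case True
  then have e: "e \<in> candidates S \<psi>"
    using assms by (auto simp: greedy_candidates_def)
  then obtain e' where e': "greedy S \<psi> = Some e'"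
    using greedy_None_iff[of S \<psi>] by auto
  with e have "marginal p f e \<psi> \<le> marginal p f e' \<psi>"
    unfolding greedy_Some_iff by blast
  then show ?thesis by (simp add: e')
next
  case False
  then show ?thesis using greedy_gain_nonneg[of \<psi> S] by linarith
qed

text \<open>A winner other than \<open>e\<close> also beats the candidates from \<open>S\<close>
  alone, under the same ranking; without a winner there are no candidates in \<open>S\<close>
  either.\<close>

lemma greedy_insert:
  assumes "greedy (insert e S) \<psi> \<noteq> Some e"
  shows "greedy (insert e S) \<psi> = greedy S \<psi>"
proof (cases "greedy (insert e S) \<psi>")
  case None
  then show ?thesis
    using greedy_None_iff[of S \<psi>] greedy_None_iff[of "insert e S" \<psi>]
    by (auto simp: greedy_candidates_def)
next
  case (Some e')
  with assms have "e' \<noteq> e" by simp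
  with Some have "greedy S \<psi> = Some e'"
    unfolding greedy_Some_iff by (auto simp: greedy_candidates_def)
  with Some show ?thesis by simp
qed

text \<open>Applying the bound for available items to \<open>insert e S\<close> reaches items
  outside the sample: as \<open>e\<close> is not taken, both sets yield the same choice.\<close>

lemma marginal_le_greedy_gain_insert:
  assumes "e \<notin> dom \<psi>" "insert e (dom \<psi>) \<in> \<I>" "greedy (insert e S) \<psi> \<noteq> Some e"
  shows "marginal p f e \<psi> \<le> greedy_gain S \<psi>"
  using marginal_le_greedy_gain[of e "insert e S" \<psi>] assms greedy_insert by simp

section \<open>Runs of the greedy policy\<close>

lemma run_greedy_indep: "dom (run (greedy S) n \<phi>) \<in> \<I>"
proof (induction n)
  case (Suc n)
  then show ?case
    using greedy_SomeD(3) by (cases "greedy S (run (greedy S) n \<phi>)") (auto simp: dom_run_Suc)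
qed (simp add: empty_indep)

lemma run_greedy_subset: "dom (run (greedy S) n \<phi>) \<subseteq> S"
proof (induction n)
  case (Suc n)
  then show ?case
    using greedy_SomeD(1) by (cases "greedy S (run (greedy S) n \<phi>)") (auto simp: dom_run_Suc)
qed simp

text \<open>Every round before stopping adds a fresh item, so after \<open>CARD('e)\<close> such
  rounds none is left.\<close>

lemma run_greedy_stops:
  assumes "CARD('e) \<le> n"
  shows "greedy S (run (greedy S) n \<phi>) = None"
proof -
  have progress: "greedy S (run (greedy S) m \<phi>) = None \<or> m \<le> card (dom (run (greedy S) m \<phi>))" for m
  proof (induction m)
    case (Suc m)
    show ?case
    proof (cases "greedy S (run (greedy S) m \<phi>)")
      case None
      then show ?thesis by (simp add: run_Suc policy_step_def)
    next
      case (Some e)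
      with Suc greedy_SomeD(2)[OF Some] show ?thesis by (simp add: dom_run_Suc)
    qed
  qed simp
  show ?thesis
  proof (rule ccontr)
    assume "greedy S (run (greedy S) n \<phi>) \<noteq> None"
    then obtain e where e: "greedy S (run (greedy S) n \<phi>) = Some e" by auto
    with progress[of n] assms have "CARD('e) \<le> card (dom (run (greedy S) n \<phi>))" by auto
    then have "dom (run (greedy S) n \<phi>) = UNIV"
      by (intro card_seteq) auto
    with greedy_SomeD(2)[OF e] show False by simp
  qed
qed

lemma run_greedy_le: "run (greedy S) n \<phi> \<subseteq>\<^sub>m run (greedy S) CARD('e) \<phi>"
proof (cases "n \<le> CARD('e)")
  case False
  then have "CARD('e) \<le> n" by simp
  then have "run (greedy S) n \<phi> = run (greedy S) CARD('e) \<phi>"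
    by (induction n rule: dec_induct) (auto simp: run_Suc policy_step_def run_greedy_stops)
  then show ?thesis by simp
qed (rule run_mono)

text \<open>The item taken next was already available one round earlier, by downward closure, with
  no smaller a marginal, and the choice made then was at least as good.\<close>

lemma greedy_gain_run_Suc:
  assumes "\<phi> \<in> set_pmf p"
  shows "greedy_gain S (run (greedy S) (Suc i) \<phi>) \<le> greedy_gain S (run (greedy S) i \<phi>)"
proof (cases "greedy S (run (greedy S) (Suc i) \<phi>)")
  case (Some e)
  note e = greedy_SomeD[OF Some]
  have "marginal p f e (run (greedy S) (Suc i) \<phi>) \<le> marginal p f e (run (greedy S) i \<phi>)"
    using e by (intro adaptive_submodularD[OF sub assms] run_consistent run_le_Suc)
  also have "\<dots> \<le> greedy_gain S (run (greedy S) i \<phi>)"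
    using e by (intro marginal_le_greedy_gain) (auto simp: dom_run_Suc intro: indep_subset)
  finally show ?thesis by (simp add: Some)
qed (simp add: greedy_gain_nonneg)

lemma card_dom_run_le: "card (dom (run (greedy S) n \<phi>)) \<le> n"
proof (induction n)
  case (Suc n)
  have "card (dom (run (greedy S) (Suc n) \<phi>)) \<le>
      card (dom (run (greedy S) n \<phi>)) + card (set_option (greedy S (run (greedy S) n \<phi>)))"
    unfolding dom_run_Suc by (rule card_Un_le)
  also have "\<dots> \<le> Suc n"
    using Suc by (cases "greedy S (run (greedy S) n \<phi>)") auto
  finally show ?case .
qed simp

section \<open>Items that greedy passes over\<close>

text \<open>While an item can be added, the greedy gain bounds its marginal; it is charged to the
  last such round. At most \<open>k * i\<close> items are blocked after \<open>i\<close> rounds, so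
  charging \<open>k\<close> items to each round suffices.\<close>

lemma sum_marginal_passed_over_le:
  assumes \<phi>: "\<phi> \<in> set_pmf p" and A: "A \<in> \<I>" "A \<inter> dom (run (greedy S) CARD('e) \<phi>) = {}"
    and pass: "\<And>e i. e \<in> A \<Longrightarrow> greedy (insert e S) (run (greedy S) i \<phi>) \<noteq> Some e"
  shows "(\<Sum>e\<in>A. marginal p f e (run (greedy S) CARD('e) \<phi>))
    \<le> real k * (\<Sum>i<CARD('e). greedy_gain S (run (greedy S) i \<phi>))"
proof -
  let ?N = "CARD('e)" and ?\<psi> = "\<lambda>i. run (greedy S) i \<phi>"
  define X where "X i = {e \<in> A. insert e (dom (?\<psi> i)) \<notin> \<I>}" for i
  have fresh: "e \<notin> dom (?\<psi> i)" if "e \<in> A" for e i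
    using A(2) that map_le_implies_dom_le[OF run_greedy_le] by blast
  have w: "marginal p f e (?\<psi> ?N) \<le> greedy_gain S (?\<psi> i)" if "e \<in> A" "e \<notin> X i" for e i
  proof -
    have "marginal p f e (?\<psi> ?N) \<le> marginal p f e (?\<psi> i)"
      using that fresh by (intro adaptive_submodularD[OF sub \<phi>] run_consistent run_greedy_le)
    also have "\<dots> \<le> greedy_gain S (?\<psi> i)"
      using that fresh pass by (intro marginal_le_greedy_gain_insert) (auto simp: X_def)
    finally show ?thesis .
  qed
  have "(\<Sum>e\<in>X ?N. marginal p f e (?\<psi> ?N)) \<le> real k * (\<Sum>i<?N. greedy_gain S (?\<psi> i))"
  proof (rule sum_le_antimono_charging)
    show "X 0 = {}"
      using A(1) by (auto simp: X_def intro: indep_subset)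
    show "X i \<subseteq> X (Suc i)" for i
      by (auto simp: X_def dom_run_Suc intro: indep_subset)
    show "card (X i) \<le> k * i" for i
    proof -
      have "card (X i) \<le> k * card (dom (?\<psi> i))"
        using k_system run_greedy_indep indep_subset[OF A(1)]
        by (intro k_system_card_le) (auto simp: X_def)
      also have "\<dots> \<le> k * i" by (intro mult_le_mono2 card_dom_run_le)
      finally show ?thesis .
    qed
    show "greedy_gain S (?\<psi> (Suc i)) \<le> greedy_gain S (?\<psi> i)" for i
      using \<phi> by (rule greedy_gain_run_Suc)
    show "marginal p f e (?\<psi> ?N) \<le> greedy_gain S (?\<psi> i)" if "e \<in> X (Suc i) - X i" for e i
      using that by (intro w) (auto simp: X_def)
  qed (auto simp: greedy_gain_nonneg)
  \<comment> \<open>Greedy has stopped by then, so its gain 0 bounds the marginals of the items that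
    can still be added.\<close>
  moreover have "(\<Sum>e\<in>A - X ?N. marginal p f e (?\<psi> ?N)) \<le> 0"
    using w[of _ ?N] by (intro sum_nonpos) (auto simp: run_greedy_stops)
  moreover have "(\<Sum>e\<in>A. marginal p f e (?\<psi> ?N)) =
      (\<Sum>e\<in>A - X ?N. marginal p f e (?\<psi> ?N)) + (\<Sum>e\<in>X ?N. marginal p f e (?\<psi> ?N))"
    by (intro sum.subset_diff) (auto simp: X_def)
  ultimately show ?thesis by linarith
qed

section \<open>Items that greedy would take if sampled\<close>

text \<open>At most one summand is nonzero. In this form the gains can be regrouped by item and
  compared between different samples.\<close>

definition item_gain :: "'e set \<Rightarrow> 'e \<Rightarrow> ('e, 'o) realization \<Rightarrow> real" where
  "item_gain S e \<phi> = (\<Sum>i<CARD('e). if greedy S (run (greedy S) i \<phi>) = Some e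
     then marginal p f e (run (greedy S) i \<phi>) else 0)"

lemma item_gain_nonneg: "item_gain S e \<phi> \<ge> 0"
  unfolding item_gain_def by (intro sum_nonneg) (auto dest: greedy_SomeD(4))

lemma item_gain_outside: "e \<notin> S \<Longrightarrow> item_gain S e \<phi> = 0"
  unfolding item_gain_def by (intro sum.neutral) (auto dest: greedy_SomeD(1))

lemma sum_item_gain: "(\<Sum>e\<in>S. item_gain S e \<phi>) = (\<Sum>i<CARD('e). greedy_gain S (run (greedy S) i \<phi>))"
proof -
  have "(\<Sum>e\<in>S. item_gain S e \<phi>) = (\<Sum>e\<in>UNIV. item_gain S e \<phi>)"
    by (intro sum.mono_neutral_left) (auto simp: item_gain_outside)
  also have "\<dots> = (\<Sum>i<CARD('e). \<Sum>e\<in>UNIV. if greedy S (run (greedy S) i \<phi>) = Some e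
     then marginal p f e (run (greedy S) i \<phi>) else 0)"
    unfolding item_gain_def by (rule sum.swap)
  also have "\<dots> = (\<Sum>i<CARD('e). greedy_gain S (run (greedy S) i \<phi>))"
    by (intro sum.cong) (auto simp: gain_def split: option.splits)
  finally show ?thesis .
qed

text \<open>Up to the first round in which \<open>e\<close> would be taken, the runs on
  \<open>S\<close> and \<open>insert e S\<close> agree. So the latter takes \<open>e\<close> given
  the observations of the former, where its marginal is at least the final one.\<close>

lemma marginal_le_item_gain:
  assumes \<phi>: "\<phi> \<in> set_pmf p" and e: "e \<notin> dom (run (greedy S) CARD('e) \<phi>)"
    and i: "greedy (insert e S) (run (greedy S) i \<phi>) = Some e"
  shows "marginal p f e (run (greedy S) CARD('e) \<phi>) \<le> item_gain (insert e S) e \<phi>"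
proof -
  let ?S' = "insert e S"
  define m where "m = (LEAST i. greedy ?S' (run (greedy S) i \<phi>) = Some e)"
  have m: "greedy ?S' (run (greedy S) m \<phi>) = Some e"
    unfolding m_def using i by (rule LeastI)
  have "run (greedy ?S') j \<phi> = run (greedy S) j \<phi>" if "j \<le> m" for j
    using that
  proof (induction j)
    case (Suc j)
    then have "greedy ?S' (run (greedy S) j \<phi>) \<noteq> Some e"
      unfolding m_def by (intro not_less_Least) simp
    with Suc show ?case by (simp add: run_Suc policy_step_def greedy_insert)
  qed simp
  then have same: "run (greedy ?S') m \<phi> = run (greedy S) m \<phi>" by simp
  have "m < CARD('e)"
    using m run_greedy_stops[of m ?S' \<phi>] same by (cases "m < CARD('e)") auto
  have "marginal p f e (run (greedy S) CARD('e) \<phi>) \<le> marginal p f e (run (greedy S) m \<phi>)"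
    using e by (intro adaptive_submodularD[OF sub \<phi>] run_consistent run_greedy_le)
  also have "\<dots> = (if greedy ?S' (run (greedy ?S') m \<phi>) = Some e
      then marginal p f e (run (greedy ?S') m \<phi>) else 0)"
    by (simp add: same m)
  also have "\<dots> \<le> item_gain ?S' e \<phi>"
    unfolding item_gain_def using \<open>m < CARD('e)\<close>
    by (intro member_le_sum) (auto dest: greedy_SomeD(4))
  finally show ?thesis .
qed

lemma sum_marginal_le:
  assumes \<phi>: "\<phi> \<in> set_pmf p" and A: "A \<in> \<I>"
  shows "(\<Sum>e\<in>A - dom (run (greedy S) CARD('e) \<phi>). marginal p f e (run (greedy S) CARD('e) \<phi>))
    \<le> real k * (\<Sum>i<CARD('e). greedy_gain S (run (greedy S) i \<phi>))
      + (\<Sum>e\<in>-S. item_gain (insert e S) e \<phi>)"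
proof -
  let ?\<psi> = "run (greedy S) CARD('e) \<phi>"
  define D where "D = {e \<in> A - dom ?\<psi>. \<exists>i. greedy (insert e S) (run (greedy S) i \<phi>) = Some e}"
  \<comment> \<open>Were \<open>e\<close> in the sample, greedy would really have taken it, and it
    would be missing from \<open>A - dom ?\<psi>\<close>.\<close>
  have outside: "e \<notin> S" if e: "e \<in> D" for e
  proof
    assume "e \<in> S"
    with e obtain i where "greedy S (run (greedy S) i \<phi>) = Some e"
      by (auto simp: D_def insert_absorb)
    then have "e \<in> dom (run (greedy S) (Suc i) \<phi>)" by (simp add: dom_run_Suc)
    then have "e \<in> dom ?\<psi>"
      by (rule subsetD[OF map_le_implies_dom_le[OF run_greedy_le]])
    with e show False by (simp add: D_def)
  qed
  have "(\<Sum>e\<in>D. marginal p f e ?\<psi>) \<le> (\<Sum>e\<in>D. item_gain (insert e S) e \<phi>)"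
    by (intro sum_mono) (auto simp: D_def intro: marginal_le_item_gain[OF \<phi>])
  also have "\<dots> \<le> (\<Sum>e\<in>-S. item_gain (insert e S) e \<phi>)"
    using outside by (intro sum_mono2) (auto simp: item_gain_nonneg)
  finally have "(\<Sum>e\<in>D. marginal p f e ?\<psi>) \<le> (\<Sum>e\<in>-S. item_gain (insert e S) e \<phi>)" .
  moreover have "(\<Sum>e\<in>A - dom ?\<psi> - D. marginal p f e ?\<psi>)
      \<le> real k * (\<Sum>i<CARD('e). greedy_gain S (run (greedy S) i \<phi>))"
    by (intro sum_marginal_passed_over_le[OF \<phi>] indep_subset[OF A]) (auto simp: D_def)
  moreover have "(\<Sum>e\<in>A - dom ?\<psi>. marginal p f e ?\<psi>) =
      (\<Sum>e\<in>A - dom ?\<psi> - D. marginal p f e ?\<psi>) + (\<Sum>e\<in>D. marginal p f e ?\<psi>)"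
    by (intro sum.subset_diff) (auto simp: D_def)
  ultimately show ?thesis by linarith
qed

section \<open>Averaging over all samples\<close>

text \<open>Adding \<open>e\<close> to \<open>S\<close> is a bijection from the pairs with
  \<open>e \<notin> S\<close> onto those with \<open>e \<in> S\<close>. It turns gains of
  hypothetical runs into gains of actual ones.\<close>

lemma sum_item_gain_insert:
  "(\<Sum>S\<in>UNIV. \<Sum>e\<in>-S. item_gain (insert e S) e \<phi>) = (\<Sum>S\<in>UNIV. \<Sum>e\<in>S. item_gain S e \<phi>)"
proof -
  have "(\<Sum>(S, e)\<in>(SIGMA S:UNIV. - S). item_gain (insert e S) e \<phi>) =
      (\<Sum>(S, e)\<in>(SIGMA S:UNIV. S). item_gain S e \<phi>)"
    by (rule sum.reindex_bij_witness[where j = "\<lambda>(S, e). (insert e S, e)" and i = "\<lambda>(S, e). (S - {e}, e)"])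
      (auto simp: insert_absorb)
  then show ?thesis by (simp add: sum.Sigma)
qed

text \<open>The gains telescope to the value of the run minus the nonnegative value of the empty
  set.\<close>

lemma sum_greedy_gain_le:
  "measure_pmf.expectation p (\<lambda>\<phi>. \<Sum>i<CARD('e). greedy_gain S (run (greedy S) i \<phi>))
    \<le> f_avg p f (return_pmf (greedy S))"
proof -
  have "adapted (\<lambda>_. Map.empty :: ('e, 'o) partial)"
    by (simp add: adapted_def consistent_def)
  from expectation_telescope[OF this, of p f "greedy S" "CARD('e)"]
  have "f_avg p f (return_pmf (greedy S)) = measure_pmf.expectation p (f {}) +
      measure_pmf.expectation p (\<lambda>\<phi>. \<Sum>i<CARD('e). greedy_gain S (run (greedy S) i \<phi>))"
    by (simp add: f_avg_return)
  moreover have "measure_pmf.expectation p (f {}) \<ge> 0"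
    by (intro integral_nonneg_AE) (simp add: nonneg)
  ultimately show ?thesis by linarith
qed

text \<open>The factor 2 comes from pairing \<open>S\<close> with \<open>- S\<close>. The factor
  \<open>k + 2\<close> counts the greedy value itself, \<open>k\<close> shares of the gains for
  items passed over and one share for the others.\<close>

lemma feasible_le_sum_greedy:
  assumes "return_pmf \<pi> \<in> feasible_policies p \<I>"
  shows "2 ^ CARD('e) * f_avg p f (return_pmf \<pi>)
    \<le> (2 * real k + 4) * (\<Sum>S\<in>UNIV. f_avg p f (return_pmf (greedy S)))"
proof -
  let ?N = "CARD('e)" and ?E = "measure_pmf.expectation p"
  let ?U = "\<lambda>S. ?E (\<lambda>\<phi>. f (dom (run \<pi> ?N \<phi>) \<union> dom (run (greedy S) ?N \<phi>)) \<phi>)"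
  let ?G = "\<lambda>S. f_avg p f (return_pmf (greedy S))"
  let ?g = "\<lambda>S \<phi>. \<Sum>i<?N. greedy_gain S (run (greedy S) i \<phi>)"
  let ?r = "\<lambda>S \<phi>. \<Sum>e\<in>-S. item_gain (insert e S) e \<phi>"
  have "f_avg p f (return_pmf \<pi>) \<le> ?U S + ?U (- S)" for S
    unfolding f_avg_return
    using run_greedy_subset[of S] run_greedy_subset[of "- S"]
    by (intro expectation_union_disjoint nonneg sub) blast
  then have "(\<Sum>S\<in>(UNIV :: 'e set set). f_avg p f (return_pmf \<pi>)) \<le> (\<Sum>S\<in>UNIV. ?U S + ?U (- S))"
    by (rule sum_mono)
  also have "\<dots> = (\<Sum>S\<in>UNIV. ?U S) + (\<Sum>S\<in>UNIV. ?U (- S))"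
    by (rule sum.distrib)
  also have "(\<Sum>S\<in>UNIV. ?U (- S)) = (\<Sum>S\<in>UNIV. ?U S)"
    by (rule sum.reindex_bij_witness[where i = uminus and j = uminus]) auto
  finally have half: "2 ^ ?N * f_avg p f (return_pmf \<pi>) \<le> 2 * (\<Sum>S\<in>UNIV. ?U S)"
    by (simp add: card_UNIV_set)
  have "?U S \<le> ?G S + real k * ?E (?g S) + ?E (?r S)" for S
  proof -
    have "?U S \<le> ?G S + ?E (\<lambda>\<phi>. \<Sum>e\<in>dom (run \<pi> ?N \<phi>) - dom (run (greedy S) ?N \<phi>).
        marginal p f e (run (greedy S) ?N \<phi>))"
      using expectation_extension_le[OF sub adapted_run, of "greedy S" ?N \<pi> ?N]
      by (simp add: f_avg_return Un_commute)
    also have "?E (\<lambda>\<phi>. \<Sum>e\<in>dom (run \<pi> ?N \<phi>) - dom (run (greedy S) ?N \<phi>).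
        marginal p f e (run (greedy S) ?N \<phi>)) \<le> ?E (\<lambda>\<phi>. real k * ?g S \<phi> + ?r S \<phi>)"
      using assms by (intro expectation_mono sum_marginal_le)
        (auto simp: feasible_policies_def selected_run)
    finally show ?thesis by simp
  qed
  then have "(\<Sum>S\<in>UNIV. ?U S) \<le> (\<Sum>S\<in>UNIV. ?G S + real k * ?E (?g S) + ?E (?r S))"
    by (rule sum_mono)
  also have "\<dots> = (\<Sum>S\<in>UNIV. ?G S) + real k * (\<Sum>S\<in>UNIV. ?E (?g S)) + (\<Sum>S\<in>UNIV. ?E (?r S))"
    by (simp only: sum.distrib sum_distrib_left)
  also have "(\<Sum>S\<in>UNIV. ?E (?r S)) = ?E (\<lambda>\<phi>. \<Sum>S\<in>UNIV. ?r S \<phi>)"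
    by (simp only: Bochner_Integration.integral_sum integrable_finite_pmf)
  also have "\<dots> = (\<Sum>S\<in>UNIV. ?E (?g S))"
    by (simp only: sum_item_gain_insert sum_item_gain Bochner_Integration.integral_sum[OF integrable_finite_pmf])
  also have "(\<Sum>S\<in>UNIV. ?G S) + real k * (\<Sum>S\<in>UNIV. ?E (?g S)) + (\<Sum>S\<in>UNIV. ?E (?g S))
      \<le> (\<Sum>S\<in>UNIV. ?G S) + real k * (\<Sum>S\<in>UNIV. ?G S) + (\<Sum>S\<in>UNIV. ?G S)"
    by (intro add_mono mult_left_mono sum_mono sum_greedy_gain_le) auto
  finally show ?thesis using half by (simp add: algebra_simps)
qed

end

theorem theorem2:
  fixes p :: "('e::finite, 'o::finite) realization pmf"
    and f :: "('e, 'o) utility"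
    and \<I> :: "'e set set"
    and k :: nat
    and rk :: "('e, 'o) partial \<Rightarrow> 'e \<Rightarrow> nat"
    and \<pi>_opt :: "('e, 'o) policy"
  assumes "\<And>S \<phi>. f S \<phi> \<ge> 0"
    and "adaptive_submodular p f"
    and "k \<ge> 1"
    and "k_system k \<I>"
    and "\<And>\<psi>. inj (rk \<psi>)"
    and "is_arg_max (f_avg p f) (\<lambda>\<pi>. \<pi> \<in> feasible_policies p \<I>) \<pi>_opt"
  shows "f_avg p f (sag_policy (1/2) (1/2) p f \<I> rk) \<ge> 1 / (2 * real k + 4) * f_avg p f \<pi>_opt"
proof -
  interpret adaptive_greedy p f \<I> k rk
    using assms by unfold_locales
  let ?sag = "f_avg p f (sag_policy (1/2) (1/2) p f \<I> rk)"
  have sag: "2 ^ CARD('e) * ?sag = (\<Sum>S\<in>UNIV. f_avg p f (return_pmf (greedy S)))"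
    unfolding sag_policy_half
    by (subst f_avg_eq) (simp add: integral_pmf_of_set card_UNIV_set)
  \<comment> \<open>Every deterministic policy in the support of \<open>\<pi>_opt\<close> is itself
    feasible, so a bound for each of them passes to their average.\<close>
  have "f_avg p f (return_pmf \<pi>) \<le> (2 * real k + 4) * ?sag" if "\<pi> \<in> set_pmf \<pi>_opt" for \<pi>
  proof -
    have "return_pmf \<pi> \<in> feasible_policies p \<I>"
      using that assms(6) by (auto simp: is_arg_max_def feasible_policies_def)
    from feasible_le_sum_greedy[OF this]
    have "2 ^ CARD('e) * f_avg p f (return_pmf \<pi>) \<le> 2 ^ CARD('e) * ((2 * real k + 4) * ?sag)"
      unfolding sag[symmetric] by (simp add: mult_ac)
    then show ?thesis by simp
  qed
  then have "f_avg p f \<pi>_opt \<le> measure_pmf.expectation \<pi>_opt (\<lambda>_. (2 * real k + 4) * ?sag)"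
    unfolding f_avg_eq[of p f \<pi>_opt] by (rule expectation_mono)
  then show ?thesis
    by (simp add: field_simps)
qed

end
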